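(* Let $K:\mathbb{Z}\to\mathbb{C}$ be positive (semi)definite and let $c_0\in\mathbb{C}$ satisfy $\operatorname{Re}c_0\ge-\tfrac12K(0)$. Consider the discrete-time equation $$y(n)=c_0x(n)+\sum_{j=0}^nK(n-j)x(j),\qquad n\ge0.\qquad(\ast)$$ Put $$c_0'=c_0-2\operatorname{Re}c_0-K(0),\qquad K'(n)=K(n)+\delta(n)\big(2\operatorname{Re}c_0+K(0)\big),$$ where $\delta(n)$ is the discrete delta function ($\delta(0)=1$, $\delta(n)=0$ otherwise), and assume $K'\neq0$. Then $K'$ is positive definite, and $(c_0',K')$ gives rise to the same equation $(\ast)$ as $(c_0,K)$, with $\operatorname{Re}c_0'=-\tfrac12K'(0)$. Let $\lambda=\mathcal{F}^{-1}[K']\in\mathcal{M}_+(S^1)$, and define $$(\mu,\zeta_0')=\mathcal{B}[\lambda,2\operatorname{Im}c_0'],\qquad J=4\mathcal{F}[\mu],\qquad\zeta_0=2i\zeta_0'-\tfrac12J(0).$$ Then equation $(\ast)$ is satisfied by $$x(n)=\zeta_0y(n)+\sum_{j=0}^nJ(n-j)y(j).$$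
   Context: A function $K:\mathbb{Z}\to\mathbb{C}$ is positive (semi)definite if for all finite $\{t_1,\dots,t_N\}\subset\mathbb{Z}$ the matrix $A_{jk}=K(t_j-t_k)$ is positive semidefinite. By Bochner's theorem such $K$ are exactly the Fourier transforms $K(n)=\mathcal{F}[\lambda](n)=\int_0^{2\pi}e^{-in\theta}\,d\lambda(\theta)$ of finite non-negative Borel measures $\lambda$ on $S^1$; $\lambda=\mathcal{F}^{-1}[K]$. $\mathcal{M}_+(S^1)$ is the set of nonzero finite non-negative Borel measures on $S^1$. For $\lambda\in\mathcal{M}_+(S^1)$, $\sigma\in\mathbb{R}$ and $z$ in the open unit disc $\mathbb{D}$, $Q_\sigma[\lambda](z)=\int_0^{2\pi}\frac{1+e^{-i\theta}z}{1-e^{-i\theta}z}\,d\lambda(\theta)+i\sigma$. For every $(\lambda,c)\in\mathcal{M}_+(S^1)\times\mathbb{R}$, $\mathcal{B}[\lambda,c]=(\mu,\zeta)$ denotes the unique pair in $\mathcal{M}_+(S^1)\times\mathbb{R}$ with $Q_c[\lambda]\,Q_\zeta[\mu]\equiv1$ on $\mathbb{D}$. *)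

theory Defs
  imports "HOL-Analysis.Analysis"
begin

text \<open>Positive semidefiniteness of a complex matrix with rows and columns indexed by a finite
  set \<open>T\<close>: the quadratic form takes real nonnegative values (over the complex numbers this
  already makes the matrix Hermitian).\<close>

definition psd_matrix :: "'i set \<Rightarrow> ('i \<Rightarrow> 'i \<Rightarrow> complex) \<Rightarrow> bool" where
  "psd_matrix T A \<longleftrightarrow>
     (\<forall>v :: 'i \<Rightarrow> complex. (\<Sum>j\<in>T. \<Sum>k\<in>T. cnj (v j) * A j k * v k) \<in> \<real>\<^sub>\<ge>\<^sub>0)"

definition positive_semidefinite :: "(int \<Rightarrow> complex) \<Rightarrow> bool" where
  "positive_semidefinite K \<longleftrightarrow> (\<forall>T. finite T \<longrightarrow> psd_matrix T (\<lambda>s t. K (s - t)))"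

text \<open>Finite Borel measures on the circle. The circle is the unit circle in the complex plane, the
  point \<open>\<omega>\<close> standing for \<open>exp (\<i> * \<theta>)\<close>; this identifies the endpoints of the
  interval from \<open>0\<close> to \<open>2 * pi\<close>, and \<open>exp (- \<i> * n * \<theta>)\<close> becomes
  \<open>\<omega> powi (- n)\<close>.\<close>

definition circle_measures :: "complex measure set" where
  "circle_measures =
     {\<nu>. sets \<nu> = sets (restrict_space borel (sphere (0::complex) 1)) \<and> finite_measure \<nu>}"

definition M_plus :: "complex measure set" where
  "M_plus = {\<nu> \<in> circle_measures. emeasure \<nu> (space \<nu>) \<noteq> 0}"

definition fourier :: "complex measure \<Rightarrow> int \<Rightarrow> complex" where
  "fourier \<nu> n = (\<integral>\<omega>. \<omega> powi (- n) \<partial>\<nu>)"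

definition fourier_inv :: "(int \<Rightarrow> complex) \<Rightarrow> complex measure" where
  "fourier_inv K = (THE \<nu>. \<nu> \<in> circle_measures \<and> fourier \<nu> = K)"

definition Q :: "real \<Rightarrow> complex measure \<Rightarrow> complex \<Rightarrow> complex" where
  "Q \<sigma> \<nu> z =
     (\<integral>\<omega>. (1 + inverse \<omega> * z) / (1 - inverse \<omega> * z) \<partial>\<nu>) + \<i> * of_real \<sigma>"

definition B :: "complex measure \<Rightarrow> real \<Rightarrow> complex measure \<times> real" where
  "B \<nu> c = (THE p. fst p \<in> M_plus \<and> (\<forall>z\<in>ball 0 1. Q c \<nu> z * Q (snd p) (fst p) z = 1))"

definition volterra :: "complex \<Rightarrow> (int \<Rightarrow> complex) \<Rightarrow> (nat \<Rightarrow> complex) \<Rightarrow> nat \<Rightarrow> complex" where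
  "volterra c K x n = c * x n + (\<Sum>j=0..n. K (int n - int j) * x j)"

end

theory Submission
  imports Defs "HOL-Probability.Helly_Selection"
begin

text \<open>
  The operator \<open>volterra c K\<close> is a causal convolution, that is, multiplication of formal power series
  by \<open>F(z) = c + K 0 + K 1 * z + K 2 * z\<^sup>2 + \<dots>\<close> (\<open>volterra_eq_fps_nth\<close>). Inverting it amounts to inverting
  \<open>F\<close>, and the point is that the inverse has the same shape. Adding \<open>d = 2 * Re c\<^sub>0 + K 0 \<ge> 0\<close> to \<open>K 0\<close> and
  subtracting it from \<open>c\<^sub>0\<close> leaves \<open>F\<close> unchanged and achieves \<open>Re c\<^sub>0' = - K' 0 / 2\<close>; then
  \<open>2 * F(z) = K' 0 + 2 * K' 1 * z + 2 * K' 2 * z\<^sup>2 + \<dots> + 2 * \<i> * Im c\<^sub>0'\<close> is precisely the Taylor series of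
  \<open>Q (2 * Im c\<^sub>0') \<lambda>\<close> (\<open>Q_sums\<close>), where \<open>\<lambda>\<close> is the measure with Fourier coefficients \<open>K'\<close>. By the choice
  of \<open>J\<close> and \<open>\<zeta>\<^sub>0\<close>, the series attached to the second equation is \<open>2 * Q \<zeta>\<^sub>0' \<mu>\<close>, so \<open>Q (2 * Im c\<^sub>0') \<lambda> * Q \<zeta>\<^sub>0' \<mu> = 1\<close> says that the two convolutions are inverse to each
  other.

  It remains to see that the objects denoted by \<open>fourier_inv\<close> and \<open>B\<close> exist and are unique.

  For \<open>fourier_inv\<close> this is the theorem of Herglotz and Bochner. Uniqueness
  (\<open>circle_measure_eqI_fourier\<close>) holds since trigonometric polynomials are uniformly dense in the
  continuous functions on the circle. For existence (\<open>herglotz_existence\<close>), positive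
  semidefiniteness says that the Fejer means of the Fourier series of \<open>K\<close> are nonnegative; they are
  densities of measures of mass \<open>K 0\<close> on \<open>[0, 2 * pi]\<close>, and a weak limit has the Fourier
  coefficients \<open>K\<close>.

  For \<open>B\<close> (\<open>B_unique_existence\<close>) one needs that the reciprocal of a Herglotz series is a Herglotz
  series. This is linear algebra: a power series is Herglotz if and only if its lower
  triangular Toeplitz matrices \<open>L\<close> have positive semidefinite Hermitian parts, and this passes to the
  inverse matrix because it is congruent to the Hermitian part of \<open>L\<close>
  (\<open>positive_semidefinite_real_part_seq_inverse\<close>).
\<close>

section \<open>Positive semidefinite sequences\<close>

lemma positive_semidefiniteD:
  assumes "positive_semidefinite K" "finite T"
  shows "(\<Sum>s\<in>T. \<Sum>t\<in>T. cnj (v s) * K (s - t) * v t) \<in> \<real>\<^sub>\<ge>\<^sub>0"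
  using assms unfolding positive_semidefinite_def psd_matrix_def by blast

lemma positive_semidefinite_at_0:
  assumes "positive_semidefinite K"
  shows "K 0 \<in> \<real>\<^sub>\<ge>\<^sub>0"
  using positive_semidefiniteD[OF assms, of "{0}" "\<lambda>_. 1"] by simp

lemma positive_semidefinite_at_0_real:
  assumes "positive_semidefinite K"
  shows "K 0 = of_real (Re (K 0))"
  using positive_semidefinite_at_0[OF assms] by (simp add: complex_nonneg_Reals_iff complex_eq_iff)

lemma positive_semidefinite_two_point:
  fixes K :: "int \<Rightarrow> complex"
  assumes "positive_semidefinite K" "n \<noteq> 0"
  shows "a * cnj a * K 0 + cnj a * K (- n) * b + cnj b * K n * a + b * cnj b * K 0 \<in> \<real>\<^sub>\<ge>\<^sub>0"
proof -
  have "(\<Sum>s\<in>{0,n}. \<Sum>t\<in>{0,n}. cnj (if s = 0 then a else b) * K (s - t) * (if t = 0 then a else b))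
      = a * cnj a * K 0 + cnj a * K (- n) * b + cnj b * K n * a + b * cnj b * K 0"
    using assms(2) by (simp add: algebra_simps)
  then show ?thesis
    using positive_semidefiniteD[OF assms(1), of "{0,n}" "\<lambda>s. if s = 0 then a else b"] by simp
qed

text \<open>With a vanishing diagonal the two-point form is odd in \<open>b\<close>, so nonnegativity for \<open>b\<close> and for
  \<open>- b\<close> makes it zero; the choices \<open>b = 1\<close> and \<open>b = \<i>\<close> then isolate \<open>K n\<close>.\<close>

lemma positive_semidefinite_eq_0:
  assumes "positive_semidefinite K" "K 0 = 0"
  shows "K = (\<lambda>_. 0)"
proof
  fix n :: int
  show "K n = 0"
  proof (cases "n = 0")
    case False
    note D = positive_semidefinite_two_point[OF assms(1) False, unfolded assms(2)]
    show ?thesis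
      using D[of 1 1] D[of 1 "-1"] D[of 1 \<i>] D[of 1 "-\<i>"]
      by (auto simp: complex_nonneg_Reals_iff complex_eq_iff)
  qed (use assms in simp)
qed

lemma positive_semidefinite_add_delta:
  assumes K: "positive_semidefinite K" and "d \<ge> 0"
  shows "positive_semidefinite (\<lambda>n. K n + (if n = 0 then of_real d else 0))"
  unfolding positive_semidefinite_def psd_matrix_def
proof (intro allI impI)
  fix T :: "int set" and v :: "int \<Rightarrow> complex"
  assume "finite T"
  have "(\<Sum>s\<in>T. \<Sum>t\<in>T. cnj (v s) * (K (s - t) + (if s - t = 0 then of_real d else 0)) * v t)
      = (\<Sum>s\<in>T. \<Sum>t\<in>T. cnj (v s) * K (s - t) * v t)
        + (\<Sum>s\<in>T. \<Sum>t\<in>T. if s = t then of_real d * (cnj (v s) * v s) else 0)"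
    unfolding sum.distrib[symmetric] by (intro sum.cong refl) (auto simp: algebra_simps)
  also have "(\<Sum>s\<in>T. \<Sum>t\<in>T. if s = t then of_real d * (cnj (v s) * v s) else 0)
      = of_real (\<Sum>s\<in>T. d * (cmod (v s))\<^sup>2)"
    using \<open>finite T\<close> by (simp add: complex_norm_square mult.commute del: of_real_power)
  also have "(\<Sum>s\<in>T. \<Sum>t\<in>T. cnj (v s) * K (s - t) * v t) + \<dots> \<in> \<real>\<^sub>\<ge>\<^sub>0"
    using \<open>d \<ge> 0\<close> \<open>finite T\<close>
    by (intro nonneg_Reals_add_I positive_semidefiniteD[OF K] nonneg_Reals_of_real_iff[THEN iffD2] sum_nonneg) auto
  finally show "(\<Sum>s\<in>T. \<Sum>t\<in>T. cnj (v s) * (K (s - t) + (if s - t = 0 then of_real d else 0)) * v t) \<in> \<real>\<^sub>\<ge>\<^sub>0" .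
qed

text \<open>Extending a test vector by zero reduces an arbitrary finite index set to an interval. Intervals
  are what products of triangular Toeplitz matrices require.\<close>

lemma positive_semidefinite_interval:
  fixes K :: "int \<Rightarrow> complex"
  assumes "\<And>m M v. (\<Sum>s\<in>{m..M}. \<Sum>t\<in>{m..M}. cnj (v s) * K (s - t) * v t) \<in> \<real>\<^sub>\<ge>\<^sub>0"
  shows "positive_semidefinite K"
  unfolding positive_semidefinite_def psd_matrix_def
proof (intro allI impI)
  fix T :: "int set" and v :: "int \<Rightarrow> complex"
  assume "finite T"
  define w where "w s = (if s \<in> T then v s else 0)" for s
  define I where "I = {Min (insert 0 T)..Max (insert 0 T)}"
  have I: "finite I" "T \<subseteq> I"
    using \<open>finite T\<close> by (auto simp: I_def)
  have "(\<Sum>s\<in>T. \<Sum>t\<in>T. cnj (v s) * K (s - t) * v t) = (\<Sum>s\<in>T. \<Sum>t\<in>T. cnj (w s) * K (s - t) * w t)"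
    by (simp add: w_def)
  also have "\<dots> = (\<Sum>s\<in>I. \<Sum>t\<in>I. cnj (w s) * K (s - t) * w t)"
    using I by (intro sum.mono_neutral_cong_left) (auto simp: w_def intro!: sum.mono_neutral_left)
  finally show "(\<Sum>j\<in>T. \<Sum>k\<in>T. cnj (v j) * K (j - k) * v k) \<in> \<real>\<^sub>\<ge>\<^sub>0"
    using assms[where v = w] unfolding I_def by simp
qed

section \<open>Measures on the circle and their Fourier coefficients\<close>

lemma circle_measuresD:
  assumes "\<nu> \<in> circle_measures"
  shows "finite_measure \<nu>" "sets \<nu> = sets (restrict_space borel (sphere 0 1))" "space \<nu> = sphere 0 1"
proof -
  show *: "finite_measure \<nu>" "sets \<nu> = sets (restrict_space borel (sphere 0 1))"
    using assms by (auto simp: circle_measures_def)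
  show "space \<nu> = sphere 0 1"
    using sets_eq_imp_space_eq[OF *(2)] by (simp add: space_restrict_space)
qed

lemma borel_measurable_circle:
  fixes f :: "complex \<Rightarrow> 'b :: topological_space"
  assumes "\<nu> \<in> circle_measures" "continuous_on (sphere 0 1) f"
  shows "f \<in> borel_measurable \<nu>"
  using borel_measurable_continuous_on_restrict[OF assms(2)]
    measurable_cong_sets[OF circle_measuresD(2)[OF assms(1)], of borel borel] by auto

lemma integrable_circle:
  fixes f :: "complex \<Rightarrow> 'b :: {banach, second_countable_topology}"
  assumes "\<nu> \<in> circle_measures" "continuous_on (sphere 0 1) f"
  shows "integrable \<nu> f"
proof -
  have "bounded (f ` sphere 0 1)"
    by (intro compact_imp_bounded compact_continuous_image assms) auto
  then obtain C where "\<forall>x\<in>sphere 0 1. norm (f x) \<le> C"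
    unfolding bounded_iff by blast
  then have "AE x in \<nu>. norm (f x) \<le> C"
    using circle_measuresD(3)[OF assms(1)] by (intro AE_I2) auto
  then show ?thesis
    using finite_measure.integrable_const_bound[OF circle_measuresD(1)[OF assms(1)]]
      borel_measurable_circle[OF assms] by blast
qed

lemma integrable_circle_powi:
  assumes "\<nu> \<in> circle_measures"
  shows "integrable \<nu> (\<lambda>\<omega>. \<omega> powi n)"
  by (intro integrable_circle assms continuous_intros) auto

lemma cnj_powi_circle:
  assumes "cmod \<omega> = 1"
  shows "cnj (\<omega> powi n) = \<omega> powi (- n)"
proof -
  have "cnj \<omega> = inverse \<omega>"
    using assms by (auto simp: inverse_eq_divide divide_conv_cnj)
  then show ?thesis
    by (simp add: power_int_minus power_int_inverse)
qed

lemma fourier_uminus: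
  assumes "\<nu> \<in> circle_measures"
  shows "fourier \<nu> (- n) = cnj (fourier \<nu> n)"
proof -
  have "fourier \<nu> (- n) = (\<integral>\<omega>. cnj (\<omega> powi (- n)) \<partial>\<nu>)"
    unfolding fourier_def
  proof (rule Bochner_Integration.integral_cong)
    fix \<omega> assume "\<omega> \<in> space \<nu>"
    then show "\<omega> powi (- (- n)) = cnj (\<omega> powi (- n))"
      using circle_measuresD(3)[OF assms] cnj_powi_circle[of \<omega> "- n"] by simp
  qed simp
  also have "\<dots> = cnj (fourier \<nu> n)"
    unfolding fourier_def by (rule Bochner_Integration.integral_cnj)
  finally show ?thesis .
qed

lemma fourier_0:
  assumes "\<nu> \<in> circle_measures"
  shows "fourier \<nu> 0 = of_real (measure \<nu> (space \<nu>))"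
  by (simp add: fourier_def scaleR_conv_of_real)

text \<open>The easy half of Bochner's theorem: the form at \<open>v\<close> is the integral of the squared modulus of
  the trigonometric polynomial with coefficients \<open>v\<close>.\<close>

lemma positive_semidefinite_fourier:
  assumes \<nu>: "\<nu> \<in> circle_measures"
  shows "positive_semidefinite (fourier \<nu>)"
  unfolding positive_semidefinite_def psd_matrix_def
proof (intro allI impI)
  fix T :: "int set" and v :: "int \<Rightarrow> complex"
  assume "finite T"
  define P where "P \<omega> = (\<Sum>t\<in>T. v t * \<omega> powi t)" for \<omega>
  have "(\<Sum>s\<in>T. \<Sum>t\<in>T. cnj (v s) * fourier \<nu> (s - t) * v t)
      = (\<integral>\<omega>. (\<Sum>s\<in>T. \<Sum>t\<in>T. cnj (v s) * \<omega> powi (- (s - t)) * v t) \<partial>\<nu>)"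
    unfolding fourier_def using integrable_circle_powi[OF \<nu>] by simp
  also have "\<dots> = (\<integral>\<omega>. of_real ((cmod (P \<omega>))\<^sup>2) \<partial>\<nu>)"
  proof (rule Bochner_Integration.integral_cong)
    fix \<omega> assume "\<omega> \<in> space \<nu>"
    then have \<omega>: "cmod \<omega> = 1" "\<omega> \<noteq> 0"
      using circle_measuresD(3)[OF \<nu>] by auto
    have "\<omega> powi (- (s - t)) = cnj (\<omega> powi s) * \<omega> powi t" for s t
      using \<omega> by (simp add: cnj_powi_circle power_int_add[symmetric] del: complex_cnj_power_int)
    moreover have "cnj (P \<omega>) * P \<omega> = (\<Sum>s\<in>T. \<Sum>t\<in>T. (cnj (v s) * cnj (\<omega> powi s)) * (v t * \<omega> powi t))"
      by (simp only: P_def cnj_sum complex_cnj_mult sum_product)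
    ultimately have "(\<Sum>s\<in>T. \<Sum>t\<in>T. cnj (v s) * \<omega> powi (- (s - t)) * v t) = cnj (P \<omega>) * P \<omega>"
      by (simp only: mult_ac)
    then show "(\<Sum>s\<in>T. \<Sum>t\<in>T. cnj (v s) * \<omega> powi (- (s - t)) * v t) = of_real ((cmod (P \<omega>))\<^sup>2)"
      by (simp add: complex_norm_square mult.commute del: of_real_power)
  qed simp
  also have "\<dots> = of_real (\<integral>\<omega>. (cmod (P \<omega>))\<^sup>2 \<partial>\<nu>)"
    by (rule integral_complex_of_real)
  finally show "(\<Sum>s\<in>T. \<Sum>t\<in>T. cnj (v s) * fourier \<nu> (s - t) * v t) \<in> \<real>\<^sub>\<ge>\<^sub>0"
    by simp
qed

lemma M_plus_iff: "\<nu> \<in> M_plus \<longleftrightarrow> \<nu> \<in> circle_measures \<and> fourier \<nu> 0 \<noteq> 0"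
  unfolding M_plus_def
  by (auto simp: fourier_0 finite_measure.emeasure_eq_measure[OF circle_measuresD(1)])

section \<open>A circle measure is determined by its Fourier coefficients\<close>

text \<open>On the circle \<open>Re \<omega>\<close> and \<open>Im \<omega>\<close> are combinations of \<open>\<omega>\<close> and its inverse, so a real polynomial
  in them is a Laurent polynomial in \<open>\<omega>\<close>. Such a Laurent polynomial is represented by an
  ordinary polynomial divided by a power of \<open>\<omega>\<close>, a form which is visibly closed under sums and
  products.\<close>

lemma real_polynomial_on_circle:
  fixes g :: "complex \<Rightarrow> real"
  assumes "real_polynomial_function g"
  shows "\<exists>p N. \<forall>\<omega>\<in>sphere 0 1. of_real (g \<omega>) * \<omega> ^ N = poly p \<omega>"
  using assms
proof induction
  case (linear f)
  have "of_real (f \<omega>) * \<omega> ^ 1 = poly [:of_real (f 1) / 2 + \<i> * of_real (f \<i>) / 2, 0,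
      of_real (f 1) / 2 - \<i> * of_real (f \<i>) / 2:] \<omega>" if "\<omega> \<in> sphere 0 1" for \<omega>
  proof -
    interpret f: bounded_linear f by fact
    have "\<omega> = Re \<omega> *\<^sub>R 1 + Im \<omega> *\<^sub>R \<i>"
      by (simp add: complex_eq_iff)
    then have f: "f \<omega> = Re \<omega> * f 1 + Im \<omega> * f \<i>"
      by (metis f.add f.scaleR real_scaleR_def)
    have "cnj \<omega> * \<omega> = 1"
      using that by (simp add: complex_norm_square[symmetric] mult.commute)
    then have re_im: "of_real (Re \<omega>) * \<omega> = (1 + \<omega> * \<omega>) / 2" "of_real (Im \<omega>) * \<omega> = \<i> * (1 - \<omega> * \<omega>) / 2"
      by (auto simp: complex_eq_iff field_simps)
    have "of_real (f \<omega>) * \<omega>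
        = of_real (f 1) * (of_real (Re \<omega>) * \<omega>) + of_real (f \<i>) * (of_real (Im \<omega>) * \<omega>)"
      by (simp add: f algebra_simps)
    then show ?thesis
      unfolding re_im by (simp add: field_simps)
  qed
  then show ?case
    by blast
next
  case (const c)
  have "of_real c * \<omega> ^ 0 = poly [:of_real c:] \<omega>" for \<omega> :: complex
    by simp
  then show ?case
    by blast
next
  case (add f g)
  then obtain p N q M where pq:
    "\<forall>\<omega>\<in>sphere 0 1. of_real (f \<omega>) * \<omega> ^ N = poly p \<omega>"
    "\<forall>\<omega>\<in>sphere 0 1. of_real (g \<omega>) * \<omega> ^ M = poly q \<omega>"
    by metis
  have "of_real (f \<omega> + g \<omega>) * \<omega> ^ (N + M) = poly (p * monom 1 M + q * monom 1 N) \<omega>"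
    if "\<omega> \<in> sphere 0 1" for \<omega>
  proof -
    have "poly (p * monom 1 M + q * monom 1 N) \<omega> = (of_real (f \<omega>) * \<omega> ^ N) * \<omega> ^ M + (of_real (g \<omega>) * \<omega> ^ M) * \<omega> ^ N"
      using pq that by (simp add: poly_monom)
    then show ?thesis
      by (simp add: power_add algebra_simps)
  qed
  then show ?case
    by blast
next
  case (mult f g)
  then obtain p N q M where pq:
    "\<forall>\<omega>\<in>sphere 0 1. of_real (f \<omega>) * \<omega> ^ N = poly p \<omega>"
    "\<forall>\<omega>\<in>sphere 0 1. of_real (g \<omega>) * \<omega> ^ M = poly q \<omega>"
    by metis
  have "of_real (f \<omega> * g \<omega>) * \<omega> ^ (N + M) = poly (p * q) \<omega>" if "\<omega> \<in> sphere 0 1" for \<omega>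
  proof -
    have "poly (p * q) \<omega> = (of_real (f \<omega>) * \<omega> ^ N) * (of_real (g \<omega>) * \<omega> ^ M)"
      using pq that by simp
    then show ?thesis
      by (simp add: power_add mult_ac)
  qed
  then show ?case
    by blast
qed

lemma integral_real_polynomial_eq_if_fourier_eq:
  assumes \<nu>: "\<nu> \<in> circle_measures" "\<nu>' \<in> circle_measures" "fourier \<nu> = fourier \<nu>'"
    and g: "real_polynomial_function g"
  shows "(\<integral>\<omega>. g \<omega> \<partial>\<nu>) = (\<integral>\<omega>. g \<omega> \<partial>\<nu>')"
proof -
  obtain p N where p: "\<forall>\<omega>\<in>sphere 0 1. of_real (g \<omega>) * \<omega> ^ N = poly p \<omega>"
    using real_polynomial_on_circle[OF g] by blast
  have pg: "of_real (g \<omega>) = (\<Sum>i\<le>degree p. coeff p i * \<omega> powi (int i - int N))"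
    if "\<omega> \<in> sphere 0 1" for \<omega>
  proof -
    from that have "\<omega> \<noteq> 0"
      by auto
    then have "of_real (g \<omega>) = poly p \<omega> / \<omega> ^ N"
      using p that by (auto simp: field_simps)
    also have "\<dots> = (\<Sum>i\<le>degree p. coeff p i * \<omega> powi (int i - int N))"
      using \<open>\<omega> \<noteq> 0\<close> by (simp add: poly_altdef power_int_diff sum_divide_distrib)
    finally show ?thesis .
  qed
  have "of_real (\<integral>\<omega>. g \<omega> \<partial>\<rho>) = (\<Sum>i\<le>degree p. coeff p i * fourier \<rho> (int N - int i))"
    if \<rho>: "\<rho> \<in> circle_measures" for \<rho>
  proof -
    have "of_real (\<integral>\<omega>. g \<omega> \<partial>\<rho>) = (\<integral>\<omega>. complex_of_real (g \<omega>) \<partial>\<rho>)"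
      by simp
    also have "\<dots> = (\<integral>\<omega>. (\<Sum>i\<le>degree p. coeff p i * \<omega> powi (int i - int N)) \<partial>\<rho>)"
      using pg circle_measuresD(3)[OF \<rho>] by (intro Bochner_Integration.integral_cong) auto
    also have "\<dots> = (\<Sum>i\<le>degree p. coeff p i * fourier \<rho> (int N - int i))"
      using integrable_circle_powi[OF \<rho>] by (simp add: fourier_def)
    finally show ?thesis .
  qed
  then show ?thesis
    using \<nu> by (metis of_real_eq_iff)
qed

text \<open>By the Stone--Weierstrass theorem, a continuous function on the circle is a uniform limit of
  real polynomials, and both integrals are continuous under uniform limits because the measures
  are finite.\<close>

lemma integral_eq_if_fourier_eq:
  fixes f :: "complex \<Rightarrow> real"
  assumes \<nu>: "\<nu> \<in> circle_measures" "\<nu>' \<in> circle_measures" "fourier \<nu> = fourier \<nu>'"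
    and f: "continuous_on (sphere 0 1) f"
  shows "(\<integral>\<omega>. f \<omega> \<partial>\<nu>) = (\<integral>\<omega>. f \<omega> \<partial>\<nu>')"
proof -
  define m where "m = measure \<nu> (space \<nu>) + measure \<nu>' (space \<nu>')"
  have bound: "\<bar>(\<integral>\<omega>. f \<omega> \<partial>\<nu>) - (\<integral>\<omega>. f \<omega> \<partial>\<nu>')\<bar> \<le> e * m" if "e > 0" for e
  proof -
    obtain g where g: "real_polynomial_function g" "\<And>x. x \<in> sphere 0 1 \<Longrightarrow> \<bar>f x - g x\<bar> < e"
      using Stone_Weierstrass_real_polynomial_function[OF _ f \<open>e > 0\<close>] by auto
    have g_cont: "continuous_on (sphere 0 1) g"
      using g(1) by (simp add: real_polynomial_function_eq continuous_on_polymonial_function)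
    have *: "\<bar>(\<integral>\<omega>. f \<omega> \<partial>\<rho>) - (\<integral>\<omega>. g \<omega> \<partial>\<rho>)\<bar> \<le> e * measure \<rho> (space \<rho>)"
      if \<rho>: "\<rho> \<in> circle_measures" for \<rho>
    proof -
      interpret finite_measure \<rho>
        using \<rho> by (rule circle_measuresD)
      have "\<bar>(\<integral>\<omega>. f \<omega> \<partial>\<rho>) - (\<integral>\<omega>. g \<omega> \<partial>\<rho>)\<bar> = \<bar>\<integral>\<omega>. f \<omega> - g \<omega> \<partial>\<rho>\<bar>"
        using integrable_circle[OF \<rho> f] integrable_circle[OF \<rho> g_cont] by simp
      also have "\<dots> \<le> (\<integral>\<omega>. \<bar>f \<omega> - g \<omega>\<bar> \<partial>\<rho>)"
        by (rule integral_abs_bound)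
      also have "\<dots> \<le> (\<integral>\<omega>. e \<partial>\<rho>)"
        using g(2) circle_measuresD(3)[OF \<rho>]
        by (intro integral_mono integrable_circle[OF \<rho>] continuous_intros f g_cont) (auto intro: less_imp_le)
      finally show ?thesis
        by (simp add: mult.commute)
    qed
    show ?thesis
      using *[OF \<nu>(1)] *[OF \<nu>(2)] integral_real_polynomial_eq_if_fourier_eq[OF \<nu> g(1)]
      by (simp add: m_def algebra_simps)
  qed
  have "\<bar>(\<integral>\<omega>. f \<omega> \<partial>\<nu>) - (\<integral>\<omega>. f \<omega> \<partial>\<nu>')\<bar> \<le> 0"
  proof (rule field_le_epsilon)
    fix e :: real assume "e > 0"
    have "m \<ge> 0"
      by (simp add: m_def)
    then have "e / (m + 1) * m \<le> e"
      using \<open>e > 0\<close> by (simp add: field_simps)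
    then show "\<bar>(\<integral>\<omega>. f \<omega> \<partial>\<nu>) - (\<integral>\<omega>. f \<omega> \<partial>\<nu>')\<bar> \<le> 0 + e"
      using bound[of "e / (m + 1)"] \<open>e > 0\<close> \<open>m \<ge> 0\<close> by simp
  qed
  then show ?thesis
    by simp
qed

text \<open>The indicator of a closed set is the pointwise limit of the continuous functions that fall
  linearly from \<open>1\<close> to \<open>0\<close> over distance \<open>1 / k\<close>.\<close>

lemma measure_closed_eq_if_fourier_eq:
  assumes \<nu>: "\<nu> \<in> circle_measures" "\<nu>' \<in> circle_measures" "fourier \<nu> = fourier \<nu>'"
    and C: "closed C"
  shows "measure \<nu> (C \<inter> sphere 0 1) = measure \<nu>' (C \<inter> sphere 0 1)"
proof (cases "C = {}")
  case False
  define f where "f k \<omega> = max 0 (1 - real k * infdist \<omega> C)" for k \<omega>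
  have f_cont: "continuous_on (sphere 0 1) (f k)" for k
    unfolding f_def by (intro continuous_intros)
  have f_lim: "(\<lambda>k. f k \<omega>) \<longlonglongrightarrow> indicator C \<omega>" for \<omega>
  proof (cases "\<omega> \<in> C")
    case False
    then have pos: "infdist \<omega> C > 0"
      using \<open>C \<noteq> {}\<close> C by (metis in_closed_iff_infdist_zero infdist_nonneg less_eq_real_def)
    obtain k0 where k0: "1 / infdist \<omega> C \<le> real k0"
      using real_arch_simple by blast
    have "eventually (\<lambda>k. f k \<omega> = 0) sequentially"
      using eventually_ge_at_top[of k0]
    proof eventually_elim
      case (elim k)
      have "1 / infdist \<omega> C \<le> real k"
        using k0 elim by linarith
      then show ?case
        using pos by (simp add: f_def field_simps)
    qed
    then show ?thesis
      using False by (simp add: tendsto_eventually)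
  qed (simp add: f_def)
  have "(\<lambda>k. \<integral>\<omega>. f k \<omega> \<partial>\<rho>) \<longlonglongrightarrow> measure \<rho> (C \<inter> sphere 0 1)" if \<rho>: "\<rho> \<in> circle_measures" for \<rho>
  proof -
    have "(\<lambda>k. \<integral>\<omega>. f k \<omega> \<partial>\<rho>) \<longlonglongrightarrow> (\<integral>\<omega>. indicator C \<omega> \<partial>\<rho>)"
    proof (rule integral_dominated_convergence)
      show "f k \<in> borel_measurable \<rho>" for k
        by (rule borel_measurable_circle[OF \<rho> f_cont])
      show "(indicator C :: _ \<Rightarrow> real) \<in> borel_measurable \<rho>"
        by (rule borel_measurable_LIMSEQ_real[OF f_lim]) (rule borel_measurable_circle[OF \<rho> f_cont])
      show "integrable \<rho> (\<lambda>\<omega>. 1 :: real)"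
        by (intro integrable_circle \<rho> continuous_intros)
      show "AE \<omega> in \<rho>. norm (f k \<omega>) \<le> 1" for k
        by (simp add: f_def infdist_nonneg)
      show "AE \<omega> in \<rho>. (\<lambda>k. f k \<omega>) \<longlonglongrightarrow> indicator C \<omega>"
        using f_lim by simp
    qed
    then show ?thesis
      using circle_measuresD(3)[OF \<rho>] by simp
  qed
  from this[OF \<nu>(1)] this[OF \<nu>(2)] show ?thesis
    using integral_eq_if_fourier_eq[OF \<nu> f_cont] by (simp add: LIMSEQ_unique)
qed simp

text \<open>The closed sets form an intersection-stable generator of the Borel sets. Pushing both measures
  forward to the whole plane makes that generator directly applicable, and no information is
  lost since the measures live on the circle.\<close>

theorem circle_measure_eqI_fourier:
  assumes \<nu>: "\<nu> \<in> circle_measures" "\<nu>' \<in> circle_measures" "fourier \<nu> = fourier \<nu>'"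
  shows "\<nu> = \<nu>'"
proof -
  let ?D = "\<lambda>\<rho>. distr \<rho> borel (\<lambda>\<omega> :: complex. \<omega>)"
  have id_meas: "(\<lambda>\<omega>. \<omega>) \<in> borel_measurable \<rho>" if "\<rho> \<in> circle_measures" for \<rho>
    by (rule borel_measurable_circle[OF that]) (rule continuous_on_id)
  have emeasure_D: "emeasure (?D \<rho>) A = emeasure \<rho> (A \<inter> sphere 0 1)"
    if "\<rho> \<in> circle_measures" "A \<in> sets borel" for \<rho> A
    using that id_meas[OF that(1)] circle_measuresD(3)[OF that(1)] by (simp add: emeasure_distr)
  have emeasure_closed: "emeasure (?D \<nu>) C = emeasure (?D \<nu>') C" if "closed C" for C
    using that \<nu> measure_closed_eq_if_fourier_eq[OF \<nu> that]
    by (simp add: emeasure_D finite_measure.emeasure_eq_measure[OF circle_measuresD(1)])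
  have D: "?D \<nu> = ?D \<nu>'"
  proof (rule measure_eqI_generator_eq[where E = "Collect closed" and \<Omega> = UNIV and A = "\<lambda>_. UNIV"])
    show "Int_stable (Collect closed :: complex set set)"
      by (auto simp: Int_stable_def)
    show "sets (?D \<nu>) = sigma_sets UNIV (Collect closed)" "sets (?D \<nu>') = sigma_sets UNIV (Collect closed)"
      by (simp_all add: borel_eq_closed)
    show "emeasure (?D \<nu>) UNIV \<noteq> \<infinity>"
      using \<nu>(1) by (simp add: emeasure_D finite_measure.emeasure_eq_measure[OF circle_measuresD(1)])
  qed (use emeasure_closed in auto)
  show ?thesis
  proof (rule measure_eqI)
    show "sets \<nu> = sets \<nu>'"
      using \<nu> by (simp add: circle_measuresD)
    fix A assume "A \<in> sets \<nu>"
    then have "A \<in> sets borel" "A \<inter> sphere 0 1 = A"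
      using circle_measuresD(2)[OF \<nu>(1)] by (auto simp: sets_restrict_space_iff)
    then show "emeasure \<nu> A = emeasure \<nu>' A"
      using emeasure_D[OF \<nu>(1)] emeasure_D[OF \<nu>(2)] D by metis
  qed
qed

section \<open>Herglotz's theorem\<close>

lemma integral_cis_int:
  "(\<integral>\<theta>. indicator {0..2 * pi} \<theta> *\<^sub>R cis (of_int n * \<theta>) \<partial>lborel) = (if n = 0 then 2 * pi else 0)"
proof (cases "n = 0")
  case False
  have "(\<integral>\<theta>. indicator {0..2 * pi} \<theta> *\<^sub>R cis (of_int n * \<theta>) \<partial>lborel)
      = cis (of_int n * (2 * pi)) / (\<i> * of_int n) - cis (of_int n * 0) / (\<i> * of_int n)"
  proof (rule integral_FTC_Icc)
    fix \<theta> :: real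
    show "((\<lambda>\<theta>. cis (of_int n * \<theta>) / (\<i> * of_int n)) has_vector_derivative cis (of_int n * \<theta>))
            (at \<theta> within {0..2 * pi})"
      unfolding cis_conv_exp of_real_mult using False
      by (intro has_vector_derivative_real_field[where f = "\<lambda>z. exp (\<i> * (of_real (of_int n) * z)) / (\<i> * of_int n)"])
         (auto intro!: derivative_eq_intros simp: mult.commute[of _ \<i>])
  qed (auto intro!: continuous_intros)
  also have "cis (of_int n * (2 * pi)) = 1"
    by (metis cis_multiple_2pi Ints_of_int mult.commute)
  finally show ?thesis
    using False by simp
qed (simp add: scaleR_conv_of_real)

text \<open>This is \<open>L\<close> times the Cesaro mean of order \<open>L\<close> of the Fourier series with coefficients \<open>K\<close>. Written as
  a double sum over a square it is literally a value of a quadratic form of \<open>K\<close>, which is why it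
  is nonnegative.\<close>

definition fejer_kernel :: "(int \<Rightarrow> complex) \<Rightarrow> nat \<Rightarrow> real \<Rightarrow> complex" where
  "fejer_kernel K L \<theta> =
     (\<Sum>s\<in>{0..<int L}. \<Sum>t\<in>{0..<int L}. K (s - t) * cis (of_int (s - t) * \<theta>))"

lemma fejer_kernel_nonneg:
  assumes "positive_semidefinite K"
  shows "fejer_kernel K L \<theta> \<in> \<real>\<^sub>\<ge>\<^sub>0"
proof -
  have "fejer_kernel K L \<theta> = (\<Sum>s\<in>{0..<int L}. \<Sum>t\<in>{0..<int L}.
          cnj (cis (- of_int s * \<theta>)) * K (s - t) * cis (- of_int t * \<theta>))"
    unfolding fejer_kernel_def
  proof (intro sum.cong refl)
    fix s t
    have "cis (of_int (s - t) * \<theta>) = cnj (cis (- of_int s * \<theta>)) * cis (- of_int t * \<theta>)"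
      unfolding cis_cnj cis_mult by (simp add: ring_distribs)
    then show "K (s - t) * cis (of_int (s - t) * \<theta>)
        = cnj (cis (- of_int s * \<theta>)) * K (s - t) * cis (- of_int t * \<theta>)"
      by simp
  qed
  then show ?thesis
    using positive_semidefiniteD[OF assms, of "{0..<int L}" "\<lambda>s. cis (- of_int s * \<theta>)"] by simp
qed

text \<open>The \<open>L\<close> by \<open>L\<close> square contains \<open>L - \<bar>n\<bar>\<close> index pairs with difference \<open>n\<close>, so this is the factor
  by which the Cesaro mean damps the \<open>n\<close>-th coefficient.\<close>

definition fejer_weight :: "nat \<Rightarrow> int \<Rightarrow> real" where
  "fejer_weight L n = of_int (max 0 (int L - \<bar>n\<bar>)) / of_nat L"

lemma fejer_weight_tendsto: "(\<lambda>L. fejer_weight L n) \<longlonglongrightarrow> 1"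
proof -
  have "(\<lambda>L. 1 - of_int \<bar>n\<bar> / real L) \<longlonglongrightarrow> 1 - 0"
    by (intro tendsto_intros lim_const_over_n)
  moreover have "eventually (\<lambda>L. fejer_weight L n = 1 - of_int \<bar>n\<bar> / real L) sequentially"
    using eventually_gt_at_top[of "nat \<bar>n\<bar>"]
    by eventually_elim (auto simp: fejer_weight_def field_simps max_def)
  ultimately show ?thesis
    by (simp add: tendsto_cong)
qed

lemma integrable_indicator_interval:
  fixes f :: "real \<Rightarrow> complex"
  assumes "continuous_on UNIV f"
  shows "integrable lborel (\<lambda>\<theta>. indicator {0..2 * pi} \<theta> *\<^sub>R f \<theta>)"
  using borel_integrable_atLeastAtMost'[of 0 "2 * pi" f] continuous_on_subset[OF assms]
  by (auto simp: set_integrable_def)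

lemma fejer_kernel_cont: "continuous_on A (fejer_kernel K L)"
  unfolding fejer_kernel_def[abs_def] by (intro continuous_intros)

lemma integral_fejer_kernel_cis:
  fixes K :: "int \<Rightarrow> complex"
  assumes "L > 0"
  shows "(\<integral>\<theta>. indicator {0..2 * pi} \<theta> *\<^sub>R (fejer_kernel K L \<theta> * cis (- (of_int n * \<theta>))) \<partial>lborel)
           = 2 * pi * L * fejer_weight L n * K n"
proof -
  let ?T = "{0..<int L}"
  have "int (card {max 0 n..<min (int L) (int L + n)}) = max 0 (int L - \<bar>n\<bar>)"
    by auto
  then have "real (card {max 0 n..<min (int L) (int L + n)}) = of_int (max 0 (int L - \<bar>n\<bar>))"
    by (metis of_int_of_nat_eq)
  also have "\<dots> = L * fejer_weight L n"
    using assms by (simp add: fejer_weight_def)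
  finally have "of_nat (card {max 0 n..<min (int L) (int L + n)}) = complex_of_real (L * fejer_weight L n)"
    by (metis of_real_of_nat_eq)
  then have card: "(\<Sum>s\<in>{max 0 n..<min (int L) (int L + n)}. 2 * pi * K n) = 2 * pi * L * fejer_weight L n * K n"
    by simp
  have "(\<integral>\<theta>. indicator {0..2 * pi} \<theta> *\<^sub>R (fejer_kernel K L \<theta> * cis (- (of_int n * \<theta>))) \<partial>lborel)
      = (\<integral>\<theta>. (\<Sum>s\<in>?T. \<Sum>t\<in>?T. K (s - t) * (indicator {0..2 * pi} \<theta> *\<^sub>R cis (of_int (s - t - n) * \<theta>))) \<partial>lborel)"
    unfolding fejer_kernel_def sum_distrib_right scaleR_sum_right
    by (intro Bochner_Integration.integral_cong sum.cong refl)
       (simp add: cis_mult algebra_simps)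
  also have "\<dots> = (\<Sum>s\<in>?T. \<Sum>t\<in>?T. K (s - t) * of_real (if s - t - n = 0 then 2 * pi else 0))"
    by (subst Bochner_Integration.integral_sum Bochner_Integration.integral_mult_right integral_cis_int
         | intro Bochner_Integration.integrable_sum Bochner_Integration.integrable_mult_right
           integrable_indicator_interval continuous_intros sum.cong refl)+
  also have "\<dots> = (\<Sum>s\<in>?T. \<Sum>t\<in>?T. if t = s - n then 2 * pi * K n else 0)"
    by (intro sum.cong refl) auto
  also have "\<dots> = (\<Sum>s\<in>?T \<inter> {s. s - n \<in> ?T}. 2 * pi * K n)"
    by (subst sum.inter_restrict) (auto intro!: sum.cong)
  also have "?T \<inter> {s. s - n \<in> ?T} = {max 0 n..<min (int L) (int L + n)}"
    by auto
  also note card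
  finally show ?thesis .
qed

text \<open>Normalised to total mass one, so that weak compactness of probability distributions on the
  line applies; the factor \<open>K 0\<close> is restored at the end.\<close>

definition fejer_density :: "(int \<Rightarrow> complex) \<Rightarrow> nat \<Rightarrow> real \<Rightarrow> real" where
  "fejer_density K L \<theta> = indicator {0..2 * pi} \<theta> * Re (fejer_kernel K L \<theta>) / (2 * pi * L * Re (K 0))"

context
  fixes K :: "int \<Rightarrow> complex" and L :: nat
  assumes K: "positive_semidefinite K" and K0: "Re (K 0) > 0" and L: "L > 0"
begin

lemma fejer_density_nonneg: "fejer_density K L \<theta> \<ge> 0"
  using fejer_kernel_nonneg[OF K, of L \<theta>] K0
  by (simp add: fejer_density_def complex_nonneg_Reals_iff)

lemma fejer_density_measurable [measurable]: "fejer_density K L \<in> borel_measurable borel"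
proof -
  have [measurable]: "fejer_kernel K L \<in> borel_measurable borel"
    by (intro borel_measurable_continuous_onI fejer_kernel_cont)
  show ?thesis
    unfolding fejer_density_def[abs_def] by measurable
qed

lemma integral_fejer_density_cis:
  "(\<integral>\<theta>. fejer_density K L \<theta> *\<^sub>R cis (- (of_int n * \<theta>)) \<partial>lborel) = fejer_weight L n * (K n / K 0)"
proof -
  have eq: "fejer_density K L \<theta> *\<^sub>R cis (- (of_int n * \<theta>))
      = (indicator {0..2 * pi} \<theta> *\<^sub>R (fejer_kernel K L \<theta> * cis (- (of_int n * \<theta>)))) / (2 * pi * L * K 0)" for \<theta>
  proof -
    have "fejer_kernel K L \<theta> = of_real (Re (fejer_kernel K L \<theta>))"
      using fejer_kernel_nonneg[OF K, of L \<theta>] by (simp add: complex_nonneg_Reals_iff complex_eq_iff)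
    moreover have "of_real (fejer_density K L \<theta>)
        = indicator {0..2 * pi} \<theta> * of_real (Re (fejer_kernel K L \<theta>)) / (2 * pi * L * K 0)"
      by (subst positive_semidefinite_at_0_real[OF K]) (simp add: fejer_density_def indicator_def)
    ultimately show ?thesis
      by (simp add: scaleR_conv_of_real indicator_def)
  qed
  show ?thesis
    unfolding eq using integral_fejer_kernel_cis[OF L, of K n] L K0 by auto
qed

lemma integrable_fejer_density: "integrable lborel (fejer_density K L)"
proof -
  have "integrable lborel (\<lambda>\<theta>. Re (indicator {0..2 * pi} \<theta> *\<^sub>R fejer_kernel K L \<theta>) / (2 * pi * L * Re (K 0)))"
    by (intro integrable_divide integrable_Re integrable_indicator_interval fejer_kernel_cont)
  then show ?thesis
    by (simp add: fejer_density_def[abs_def])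
qed

lemma nn_integral_fejer_density: "(\<integral>\<^sup>+\<theta>. fejer_density K L \<theta> \<partial>lborel) = 1"
proof -
  have "of_real (\<integral>\<theta>. fejer_density K L \<theta> \<partial>lborel) = (\<integral>\<theta>. fejer_density K L \<theta> *\<^sub>R cis (- (of_int 0 * \<theta>)) \<partial>lborel)"
    by (simp add: scaleR_conv_of_real)
  also have "\<dots> = 1"
    unfolding integral_fejer_density_cis using K0 L by (auto simp: fejer_weight_def)
  finally have "(\<integral>\<theta>. fejer_density K L \<theta> \<partial>lborel) = 1"
    by (metis of_real_eq_1_iff)
  then show ?thesis
    using integrable_fejer_density fejer_density_nonneg by (subst nn_integral_eq_integral) auto
qed

lemma emeasure_fejer_density:
  assumes "{0..2 * pi} \<subseteq> A" "A \<in> sets borel"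
  shows "emeasure (density lborel (fejer_density K L)) A = 1"
proof -
  have "emeasure (density lborel (fejer_density K L)) A
      = (\<integral>\<^sup>+\<theta>. ennreal (fejer_density K L \<theta>) * indicator A \<theta> \<partial>lborel)"
    using assms by (subst emeasure_density) auto
  also have "\<dots> = (\<integral>\<^sup>+\<theta>. fejer_density K L \<theta> \<partial>lborel)"
    using assms(1) by (intro nn_integral_cong) (auto simp: fejer_density_def indicator_def)
  finally show ?thesis
    by (simp add: nn_integral_fejer_density)
qed

lemma real_distribution_fejer_density: "real_distribution (density lborel (fejer_density K L))"
  unfolding real_distribution_def real_distribution_axioms_def
  by (auto intro!: prob_spaceI simp: emeasure_fejer_density)

end

text \<open>All densities live on \<open>{0..2 * pi}\<close>. The index is shifted because the density of order \<open>0\<close>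
  vanishes.\<close>

lemma tight_fejer_density:
  assumes "positive_semidefinite K" "Re (K 0) > 0"
  shows "tight (\<lambda>N. density lborel (fejer_density K (Suc N)))"
  unfolding tight_def
proof (intro conjI allI impI)
  fix N show "real_distribution (density lborel (fejer_density K (Suc N)))"
    by (rule real_distribution_fejer_density[OF assms]) simp
next
  fix \<epsilon> :: real assume "\<epsilon> > 0"
  \<comment> \<open>Tightness is phrased with intervals open on the left, so the left end must be below \<open>0\<close>.\<close>
  have "measure (density lborel (fejer_density K (Suc N))) {-1<..2 * pi} = 1" for N
    unfolding measure_def by (subst emeasure_fejer_density[OF assms]) auto
  moreover have "-1 < 2 * pi"
    using pi_gt_zero by linarith
  ultimately show "\<exists>a b. a < b \<and> (\<forall>N. 1 - \<epsilon> < measure (density lborel (fejer_density K (Suc N))) {a<..b})"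
    using \<open>\<epsilon> > 0\<close> by (intro exI[of _ "-1"] exI[of _ "2 * pi"]) simp
qed

text \<open>Helly's selection theorem yields a weak limit of a subsequence of the Fejer densities; weak
  convergence passes to the integrals of the bounded continuous functions
  \<open>\<theta> \<mapsto> cis (- n * \<theta>)\<close>, and these integrals tend to \<open>K n / K 0\<close> because the Fejer weights tend to one.\<close>

lemma real_distribution_with_moments:
  assumes K: "positive_semidefinite K" and K0: "Re (K 0) > 0"
  shows "\<exists>M. real_distribution M \<and> (\<forall>n. (\<integral>\<theta>. cis (- (of_int n * \<theta>)) \<partial>M) = K n / K 0)"
proof -
  let ?\<mu> = "\<lambda>N. density lborel (fejer_density K (Suc N))"
  obtain r M where r: "strict_mono r" and M: "real_distribution M"
    and conv: "weak_conv_m (?\<mu> \<circ> id \<circ> r) M"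
    using tight_imp_convergent_subsubsequence[OF tight_fejer_density[OF K K0] strict_mono_id] by blast
  have "(\<integral>\<theta>. cis (- (of_int n * \<theta>)) \<partial>M) = K n / K 0" for n
  proof (rule LIMSEQ_unique)
    show "(\<lambda>N. \<integral>\<theta>. cis (- (of_int n * \<theta>)) \<partial>(?\<mu> \<circ> id \<circ> r) N) \<longlonglongrightarrow> (\<integral>\<theta>. cis (- (of_int n * \<theta>)) \<partial>M)"
    proof (rule weak_conv_imp_integral_bdd_continuous_conv[OF _ M conv, where B = 1])
      fix N show "real_distribution ((?\<mu> \<circ> id \<circ> r) N)"
        using real_distribution_fejer_density[OF K K0] by simp
      have "continuous_on UNIV (\<lambda>\<theta>. cis (- (of_int n * \<theta>)))"
        by (intro continuous_intros)
      then show "isCont (\<lambda>\<theta>. cis (- (of_int n * \<theta>))) \<theta>" for \<theta>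
        by (simp add: continuous_on_eq_continuous_at)
    qed simp
    have "(\<lambda>N. of_real (fejer_weight (Suc (r N)) n) * (K n / K 0)) \<longlonglongrightarrow> of_real 1 * (K n / K 0)"
      by (intro tendsto_intros LIMSEQ_subseq_LIMSEQ[OF LIMSEQ_Suc[OF fejer_weight_tendsto] r, unfolded o_def])
    moreover have "(\<integral>\<theta>. cis (- (of_int n * \<theta>)) \<partial>?\<mu> N) = of_real (fejer_weight (Suc N) n) * (K n / K 0)" for N
      using fejer_density_nonneg[OF K K0] fejer_density_measurable[OF K K0]
      by (subst integral_density)
         (auto intro!: borel_measurable_continuous_onI continuous_intros
           simp: integral_fejer_density_cis[OF K K0])
    ultimately show "(\<lambda>N. \<integral>\<theta>. cis (- (of_int n * \<theta>)) \<partial>(?\<mu> \<circ> id \<circ> r) N) \<longlonglongrightarrow> K n / K 0"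
      by simp
  qed
  then show ?thesis
    using M by blast
qed

text \<open>The limit distribution on the line is wrapped around the circle by \<open>cis\<close>. A sequence with
  \<open>K 0 = 0\<close> cannot be normalised, but it vanishes identically and comes from the null measure.\<close>

theorem herglotz_existence:
  assumes K: "positive_semidefinite K"
  shows "\<exists>\<nu>\<in>circle_measures. fourier \<nu> = K"
proof (cases "K 0 = 0")
  case True
  let ?\<nu> = "null_measure (restrict_space borel (sphere (0 :: complex) 1))"
  have "?\<nu> \<in> circle_measures"
    by (auto simp: circle_measures_def intro: finite_measureI)
  moreover have "fourier ?\<nu> = K"
    using positive_semidefinite_eq_0[OF K True] by (simp add: fourier_def fun_eq_iff)
  ultimately show ?thesis
    by blast
next
  case False
  define k where "k = Re (K 0)"
  have k: "K 0 = of_real k" "k > 0"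
    using positive_semidefinite_at_0[OF K] False
    by (auto simp: complex_nonneg_Reals_iff complex_eq_iff k_def less_le)
  obtain M where M: "real_distribution M" "\<And>n. (\<integral>\<theta>. cis (- (of_int n * \<theta>)) \<partial>M) = K n / K 0"
    using real_distribution_with_moments[OF K] k(2) k_def by blast
  interpret real_distribution M by fact
  let ?S = "restrict_space borel (sphere (0 :: complex) 1)"
  define \<nu> where "\<nu> = distr (density M (\<lambda>_. ennreal k)) ?S cis"
  have [measurable]: "cis \<in> borel_measurable borel"
    by (intro borel_measurable_continuous_onI continuous_intros)
  have cis_meas: "cis \<in> measurable (density M (\<lambda>_. ennreal k)) ?S"
    by (intro measurable_restrict_space2) auto
  have "finite_measure (density M (\<lambda>_. ennreal k))"
    by (intro finite_measureI) (simp add: emeasure_density_const emeasure_eq_measure ennreal_mult_eq_top_iff)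
  then have "\<nu> \<in> circle_measures"
    unfolding circle_measures_def \<nu>_def using finite_measure.finite_measure_distr[OF _ cis_meas] by auto
  moreover have "fourier \<nu> n = K n" for n
  proof -
    have "fourier \<nu> n = (\<integral>\<theta>. cis \<theta> powi (- n) \<partial>density M (\<lambda>_. ennreal k))"
      unfolding fourier_def \<nu>_def
      by (intro integral_distr[OF cis_meas] borel_measurable_continuous_on_restrict continuous_intros) auto
    also have "\<dots> = (\<integral>\<theta>. k *\<^sub>R cis (- (of_int n * \<theta>)) \<partial>M)"
      using k(2) by (subst integral_density) (auto simp: cis_power_int)
    also have "\<dots> = K n"
      using k M(2)[of n] by (simp add: scaleR_conv_of_real)
    finally show ?thesis .
  qed
  ultimately show ?thesis
    by blast
qed

theorem fourier_inv_eq: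
  assumes "positive_semidefinite K"
  shows "fourier_inv K \<in> circle_measures" "fourier (fourier_inv K) = K"
proof -
  have "\<exists>!\<nu>. \<nu> \<in> circle_measures \<and> fourier \<nu> = K"
    using herglotz_existence[OF assms] circle_measure_eqI_fourier by blast
  from theI'[OF this] show "fourier_inv K \<in> circle_measures" "fourier (fourier_inv K) = K"
    by (auto simp: fourier_inv_def)
qed

section \<open>Reciprocals of power series with positive semidefinite real part\<close>

text \<open>The first column and row, read along the diagonals, of the lower triangular Toeplitz matrix
  that represents multiplication by \<open>a\<close>.\<close>

definition toeplitz :: "complex fps \<Rightarrow> int \<Rightarrow> complex" where
  "toeplitz a n = (if n \<ge> 0 then fps_nth a (nat n) else 0)"

text \<open>The Hermitian part of that matrix. If \<open>a\<close> is the Taylor series of a function on the disc, these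
  are the formal Fourier coefficients of the real part of its boundary values.\<close>

definition real_part_seq :: "complex fps \<Rightarrow> int \<Rightarrow> complex" where
  "real_part_seq a n = (toeplitz a n + cnj (toeplitz a (- n))) / 2"

lemma toeplitz_form_real_part_seq:
  "(\<Sum>s\<in>T. \<Sum>t\<in>T. cnj (v s) * real_part_seq a (s - t) * v t)
     = of_real (Re (\<Sum>s\<in>T. \<Sum>t\<in>T. cnj (v s) * toeplitz a (s - t) * v t))"
proof -
  let ?X = "\<Sum>s\<in>T. \<Sum>t\<in>T. cnj (v s) * toeplitz a (s - t) * v t"
  have "cnj ?X = (\<Sum>s\<in>T. \<Sum>t\<in>T. v s * cnj (toeplitz a (s - t)) * cnj (v t))"
    by simp
  also have "\<dots> = (\<Sum>s\<in>T. \<Sum>t\<in>T. cnj (v s) * cnj (toeplitz a (- (s - t))) * v t)"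
    by (subst sum.swap) (simp add: algebra_simps)
  finally have "(\<Sum>s\<in>T. \<Sum>t\<in>T. cnj (v s) * real_part_seq a (s - t) * v t) = (?X + cnj ?X) / 2"
    by (simp add: real_part_seq_def sum.distrib[symmetric] sum_divide_distrib field_simps)
  also have "\<dots> = of_real (Re ?X)"
    by (subst complex_add_cnj) simp
  finally show ?thesis .
qed

text \<open>On an interval of indices only the terms with \<open>t \<le> u \<le> s\<close> survive, and all of these lie in
  the interval; the sum over them is the Cauchy product. So truncation does not spoil
  multiplicativity.\<close>

lemma toeplitz_mult:
  assumes "s \<in> {m..M}" "t \<in> {m..M}"
  shows "(\<Sum>u\<in>{m..M}. toeplitz b (s - u) * toeplitz a (u - t)) = toeplitz (b * a) (s - t)"
proof (cases "s < t")
  case True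
  then have "toeplitz b (s - u) * toeplitz a (u - t) = 0" for u
    by (auto simp: toeplitz_def)
  then have "(\<Sum>u\<in>{m..M}. toeplitz b (s - u) * toeplitz a (u - t)) = 0"
    by (intro sum.neutral) blast
  then show ?thesis
    using True by (simp add: toeplitz_def)
next
  case False
  have "(\<Sum>u\<in>{m..M}. toeplitz b (s - u) * toeplitz a (u - t))
      = (\<Sum>u\<in>{t..s}. toeplitz b (s - u) * toeplitz a (u - t))"
    using assms by (intro sum.mono_neutral_right) (auto simp: toeplitz_def)
  also have "\<dots> = (\<Sum>i=0..nat (s - t). fps_nth b i * fps_nth a (nat (s - t) - i))"
    using False by (intro sum.reindex_bij_witness[of _ "\<lambda>i. s - int i" "\<lambda>u. nat (s - u)"])
       (auto simp: toeplitz_def nat_diff_distrib' intro!: arg_cong[where f="fps_nth a"])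
  also have "\<dots> = toeplitz (b * a) (s - t)"
    using False by (simp add: toeplitz_def fps_mult_nth)
  finally show ?thesis .
qed

text \<open>The matrix form of the fact that the reciprocal of a function with positive real part has
  positive real part; it produces the dual measure. If \<open>L\<close> is the truncated
  Toeplitz matrix of \<open>a\<close>, the one of \<open>b\<close> is \<open>M = L\<close>-inverse, and
  \<open>M + M* = M (L + L*) M*\<close>: the form of \<open>b\<close> at \<open>v\<close> is the form of \<open>a\<close> at \<open>w = M* v\<close>.\<close>

lemma positive_semidefinite_real_part_seq_inverse:
  assumes a: "positive_semidefinite (real_part_seq a)" and ba: "b * a = 1"
  shows "positive_semidefinite (real_part_seq b)"
proof (rule positive_semidefinite_interval)
  fix m M :: int and v :: "int \<Rightarrow> complex"
  define w where "w u = (\<Sum>s\<in>{m..M}. cnj (toeplitz b (s - u)) * v s)" for u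
  have w: "(\<Sum>u\<in>{m..M}. cnj (w u) * toeplitz a (u - t)) = cnj (v t)" if t: "t \<in> {m..M}" for t
  proof -
    have "(\<Sum>u\<in>{m..M}. cnj (w u) * toeplitz a (u - t))
        = (\<Sum>u\<in>{m..M}. \<Sum>s\<in>{m..M}. cnj (v s) * (toeplitz b (s - u) * toeplitz a (u - t)))"
      by (simp add: w_def sum_distrib_right sum_distrib_left algebra_simps)
    also have "\<dots> = (\<Sum>s\<in>{m..M}. cnj (v s) * toeplitz 1 (s - t))"
      by (subst sum.swap) (simp add: sum_distrib_left[symmetric] toeplitz_mult[OF _ t] ba)
    also have "\<dots> = (\<Sum>s\<in>{m..M}. if s = t then cnj (v s) else 0)"
      by (intro sum.cong) (auto simp: toeplitz_def)
    finally show ?thesis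
      using t by simp
  qed
  have "(\<Sum>u\<in>{m..M}. \<Sum>t\<in>{m..M}. cnj (w u) * toeplitz a (u - t) * w t)
      = (\<Sum>t\<in>{m..M}. (\<Sum>u\<in>{m..M}. cnj (w u) * toeplitz a (u - t)) * w t)"
    by (subst sum.swap) (simp add: sum_distrib_right)
  also have "\<dots> = (\<Sum>t\<in>{m..M}. cnj (v t) * w t)"
    by (simp add: w)
  also have "\<dots> = cnj (\<Sum>s\<in>{m..M}. \<Sum>t\<in>{m..M}. cnj (v s) * toeplitz b (s - t) * v t)"
    by (subst sum.swap) (simp add: w_def sum_distrib_left mult_ac)
  finally have "(\<Sum>s\<in>{m..M}. \<Sum>t\<in>{m..M}. cnj (v s) * real_part_seq b (s - t) * v t)
      = (\<Sum>u\<in>{m..M}. \<Sum>t\<in>{m..M}. cnj (w u) * real_part_seq a (u - t) * w t)"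
    unfolding toeplitz_form_real_part_seq by (simp only: cnj.simps)
  then show "(\<Sum>s\<in>{m..M}. \<Sum>t\<in>{m..M}. cnj (v s) * real_part_seq b (s - t) * v t) \<in> \<real>\<^sub>\<ge>\<^sub>0"
    using positive_semidefiniteD[OF a, of "{m..M}" w] by simp
qed

section \<open>The Herglotz transform as a power series\<close>

text \<open>The Taylor series at the origin of the Herglotz transform \<open>Q \<sigma> \<nu>\<close>. Working with it turns
  identities between functions on the disc into identities in the ring of formal power
  series.\<close>

definition herglotz_fps :: "real \<Rightarrow> complex measure \<Rightarrow> complex fps" where
  "herglotz_fps \<sigma> \<nu> = Abs_fps (\<lambda>n. if n = 0 then fourier \<nu> 0 + \<i> * of_real \<sigma> else 2 * fourier \<nu> (int n))"

text \<open>Expand \<open>(1 + q) / (1 - q) = 1 + 2 * q + 2 * q\<^sup>2 + \<dots>\<close> at \<open>q = inverse \<omega> * z\<close> and integrate termwise;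
  on the circle the terms are bounded by \<open>2 * \<bar>z\<bar> ^ n\<close>, uniformly in \<open>\<omega>\<close>.\<close>

lemma Q_sums:
  assumes \<nu>: "\<nu> \<in> circle_measures" and z: "cmod z < 1"
  shows "(\<lambda>n. fps_nth (herglotz_fps \<sigma> \<nu>) n * z ^ n) sums Q \<sigma> \<nu> z"
proof -
  define w :: "nat \<Rightarrow> complex" where "w n = (if n = 0 then 1 else 2)" for n
  define g where "g n \<omega> = w n * (inverse \<omega> * z) ^ n" for n \<omega>
  have w_le: "cmod (w n) \<le> 2" for n
    by (simp add: w_def)
  have g_norm: "cmod (g n \<omega>) = cmod (w n) * cmod z ^ n" if "\<omega> \<in> space \<nu>" for n \<omega>
    using that circle_measuresD(3)[OF \<nu>] by (simp add: g_def norm_mult norm_power norm_inverse)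
  have summ: "summable (\<lambda>n. cmod (w n) * cmod z ^ n)"
    by (rule summable_comparison_test[of _ "\<lambda>n. 2 * cmod z ^ n"])
       (use z w_le in \<open>auto intro!: exI[of _ 0] mult_right_mono summable_mult summable_geometric\<close>)
  have g_sums: "(\<lambda>n. g n \<omega>) sums ((1 + inverse \<omega> * z) / (1 - inverse \<omega> * z))" if "\<omega> \<in> space \<nu>" for \<omega>
  proof -
    let ?q = "inverse \<omega> * z"
    have q: "cmod ?q < 1"
      using that circle_measuresD(3)[OF \<nu>] z by (simp add: norm_mult norm_inverse)
    then have "?q \<noteq> 1"
      by auto
    have series: "(\<lambda>n. 2 * ?q ^ n - (if n = 0 then 1 else 0)) sums (2 * (1 / (1 - ?q)) - 1)"
      using sums_single[of 0 "\<lambda>_. 1 :: complex"]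
      by (intro sums_diff sums_mult geometric_sums q) simp
    have "2 * (1 / (1 - q)) - 1 = (1 + q) / (1 - q)" if "q \<noteq> 1" for q :: complex
      using that by (simp add: field_simps)
    from this[OF \<open>?q \<noteq> 1\<close>] have "2 * (1 / (1 - ?q)) - 1 = (1 + ?q) / (1 - ?q)" .
    moreover note series
    moreover have "(\<lambda>n. 2 * ?q ^ n - (if n = 0 then 1 else 0)) = (\<lambda>n. g n \<omega>)"
      by (auto simp: g_def w_def fun_eq_iff)
    ultimately show ?thesis
      by simp
  qed
  have "(\<lambda>n. \<integral>\<omega>. g n \<omega> \<partial>\<nu>) sums (\<integral>\<omega>. (\<Sum>n. g n \<omega>) \<partial>\<nu>)"
  proof (rule sums_integral)
    show "integrable \<nu> (g n)" for n
      unfolding g_def by (intro integrable_circle[OF \<nu>] continuous_intros) auto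
    show "AE \<omega> in \<nu>. summable (\<lambda>n. cmod (g n \<omega>))"
      using summ by (intro AE_I2) (simp add: g_norm)
    have "(\<integral>\<omega>. cmod (g n \<omega>) \<partial>\<nu>) = (\<integral>\<omega>. cmod (w n) * cmod z ^ n \<partial>\<nu>)" for n
      by (intro Bochner_Integration.integral_cong refl g_norm)
    then show "summable (\<lambda>n. \<integral>\<omega>. cmod (g n \<omega>) \<partial>\<nu>)"
      using summable_mult[OF summ, of "measure \<nu> (space \<nu>)"] by (simp add: mult.assoc)
  qed
  also have "(\<integral>\<omega>. (\<Sum>n. g n \<omega>) \<partial>\<nu>) = (\<integral>\<omega>. (1 + inverse \<omega> * z) / (1 - inverse \<omega> * z) \<partial>\<nu>)"
    using g_sums by (intro Bochner_Integration.integral_cong) (auto simp: sums_iff)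
  finally have "(\<lambda>n. (\<integral>\<omega>. g n \<omega> \<partial>\<nu>) + (if n = 0 then \<i> * of_real \<sigma> else 0)) sums Q \<sigma> \<nu> z"
    unfolding Q_def using sums_single[of 0 "\<lambda>_. \<i> * complex_of_real \<sigma>"] by (intro sums_add) simp_all
  moreover have "(\<integral>\<omega>. g n \<omega> \<partial>\<nu>) = w n * fourier \<nu> (int n) * z ^ n" for n
  proof -
    have "g n \<omega> = w n * z ^ n * \<omega> powi (- int n)" for \<omega>
      by (simp add: g_def power_mult_distrib power_int_minus power_inverse)
    then show ?thesis
      by (simp add: fourier_def)
  qed
  then have "(\<integral>\<omega>. g n \<omega> \<partial>\<nu>) + (if n = 0 then \<i> * of_real \<sigma> else 0)
      = fps_nth (herglotz_fps \<sigma> \<nu>) n * z ^ n" for n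
    by (simp add: herglotz_fps_def w_def)
  ultimately show ?thesis
    by simp
qed

lemma fps_conv_radius_herglotz_fps:
  assumes "\<nu> \<in> circle_measures"
  shows "fps_conv_radius (herglotz_fps \<sigma> \<nu>) \<ge> 1"
  unfolding fps_conv_radius_def
proof (rule conv_radius_geI_ex')
  fix r :: real assume "0 < r" "ereal r < 1"
  then show "summable (\<lambda>n. fps_nth (herglotz_fps \<sigma> \<nu>) n * of_real r ^ n)"
    using Q_sums[OF assms, of "of_real r" \<sigma>] by (auto simp: sums_iff one_ereal_def)
qed

lemma eval_herglotz_fps:
  assumes "\<nu> \<in> circle_measures" "cmod z < 1"
  shows "eval_fps (herglotz_fps \<sigma> \<nu>) z = Q \<sigma> \<nu> z"
  using Q_sums[OF assms] by (simp add: eval_fps_def sums_iff)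

text \<open>Both series converge on the disc, where the value of a product is the product of the values;
  conversely a power series is determined by its values near the origin.\<close>

lemma Q_mult_eq_1_iff:
  assumes \<nu>: "\<nu> \<in> circle_measures" and \<rho>: "\<rho> \<in> circle_measures"
  shows "(\<forall>z\<in>ball 0 1. Q \<sigma> \<nu> z * Q \<tau> \<rho> z = 1) \<longleftrightarrow> herglotz_fps \<sigma> \<nu> * herglotz_fps \<tau> \<rho> = 1"
proof -
  let ?f = "herglotz_fps \<sigma> \<nu>" and ?g = "herglotz_fps \<tau> \<rho>"
  have radius: "fps_conv_radius ?f \<ge> 1" "fps_conv_radius ?g \<ge> 1"
    using assms by (auto intro: fps_conv_radius_herglotz_fps)
  have eval: "eval_fps (?f * ?g) z = Q \<sigma> \<nu> z * Q \<tau> \<rho> z" if "z \<in> ball 0 1" for z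
  proof -
    have "ereal (cmod z) < 1"
      using that by (simp add: one_ereal_def)
    then have "ereal (cmod z) < fps_conv_radius ?f" "ereal (cmod z) < fps_conv_radius ?g"
      using radius less_le_trans by blast+
    then show ?thesis
      using that \<nu> \<rho> by (simp add: eval_fps_mult eval_herglotz_fps)
  qed
  show ?thesis
  proof
    assume Q: "\<forall>z\<in>ball 0 1. Q \<sigma> \<nu> z * Q \<tau> \<rho> z = 1"
    show "?f * ?g = 1"
    proof (rule eval_fps_eqD)
      have "(1 :: ereal) \<le> min (fps_conv_radius ?f) (fps_conv_radius ?g)"
        using radius by simp
      also have "\<dots> \<le> fps_conv_radius (?f * ?g)"
        by (rule fps_conv_radius_mult)
      finally show "fps_conv_radius (?f * ?g) > 0"
        by (rule less_le_trans[rotated]) simp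
      have "eventually (\<lambda>z :: complex. z \<in> ball 0 1) (nhds 0)"
        by (intro eventually_nhds_in_open) auto
      then show "eventually (\<lambda>z. eval_fps (?f * ?g) z = eval_fps 1 z) (nhds 0)"
        by eventually_elim (use eval Q in simp)
    qed simp
  qed (use eval in force)
qed

section \<open>The dual measure\<close>

lemma fourier_eq_real_part_seq:
  assumes "\<nu> \<in> circle_measures"
  shows "fourier \<nu> = real_part_seq (herglotz_fps \<sigma> \<nu>)"
proof
  fix n :: int
  consider "n = 0" | "n > 0" | "n < 0"
    by linarith
  then show "fourier \<nu> n = real_part_seq (herglotz_fps \<sigma> \<nu>) n"
    by cases (auto simp: real_part_seq_def toeplitz_def herglotz_fps_def fourier_uminus[OF assms]
        fourier_0[OF assms])
qed

lemma herglotz_fps_inject: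
  assumes "\<nu> \<in> circle_measures" "\<rho> \<in> circle_measures" "herglotz_fps \<sigma> \<nu> = herglotz_fps \<tau> \<rho>"
  shows "\<nu> = \<rho>" "\<sigma> = \<tau>"
proof -
  show *: "\<nu> = \<rho>"
    using assms fourier_eq_real_part_seq by (metis circle_measure_eqI_fourier)
  have "fps_nth (herglotz_fps \<sigma> \<nu>) 0 = fps_nth (herglotz_fps \<tau> \<rho>) 0"
    using assms by simp
  then show "\<sigma> = \<tau>"
    by (simp add: herglotz_fps_def *)
qed

text \<open>The Herglotz--Riesz representation theorem, stated for coefficients.\<close>

lemma herglotz_representation:
  assumes "positive_semidefinite (real_part_seq b)"
  obtains \<nu> where "\<nu> \<in> circle_measures" "herglotz_fps (Im (fps_nth b 0)) \<nu> = b"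
proof -
  obtain \<nu> where \<nu>: "\<nu> \<in> circle_measures" "fourier \<nu> = real_part_seq b"
    using herglotz_existence[OF assms] by blast
  have "fps_nth (herglotz_fps (Im (fps_nth b 0)) \<nu>) n = fps_nth b n" for n
    by (auto simp: herglotz_fps_def \<nu>(2) real_part_seq_def toeplitz_def complex_eq_iff)
  then show thesis
    using that \<nu>(1) by (metis fps_ext)
qed

text \<open>On the level of power series the condition on the pair says that its series is the reciprocal
  of that of \<open>(\<nu>, c)\<close>. The reciprocal exists because the constant coefficient has real part
  \<open>fourier \<nu> 0 > 0\<close>, and it is again the series of a measure and a real constant; a series
  determines both.\<close>

theorem B_unique_existence:
  assumes "\<nu> \<in> M_plus"
  shows "\<exists>!p. fst p \<in> M_plus \<and> (\<forall>z\<in>ball 0 1. Q c \<nu> z * Q (snd p) (fst p) z = 1)"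
proof -
  let ?a = "herglotz_fps c \<nu>"
  have \<nu>: "\<nu> \<in> circle_measures" "fourier \<nu> 0 \<noteq> 0"
    using assms by (auto simp: M_plus_iff)
  have Re_a0: "Re (fps_nth ?a 0) \<noteq> 0"
    using \<nu> by (simp add: herglotz_fps_def fourier_0)
  then have ba: "inverse ?a * ?a = 1"
    by (intro inverse_mult_eq_1) auto
  have "positive_semidefinite (real_part_seq ?a)"
    using positive_semidefinite_fourier[OF \<nu>(1)] fourier_eq_real_part_seq[OF \<nu>(1)] by metis
  then obtain \<mu> \<zeta> where \<mu>: "\<mu> \<in> circle_measures" "herglotz_fps \<zeta> \<mu> = inverse ?a"
    using herglotz_representation[OF positive_semidefinite_real_part_seq_inverse[OF _ ba]] by metis
  have "Re (fourier \<mu> 0) = Re (inverse (fps_nth ?a 0))"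
    using arg_cong[OF \<mu>(2), of "\<lambda>f. Re (fps_nth f 0)"] by (simp add: herglotz_fps_def)
  also have "\<dots> \<noteq> 0"
    using Re_a0 by (simp add: sum_power2_eq_zero_iff)
  finally have "\<mu> \<in> M_plus"
    using \<mu>(1) by (auto simp: M_plus_iff)
  show ?thesis
  proof (rule ex1I[of _ "(\<mu>, \<zeta>)"])
    show "fst (\<mu>, \<zeta>) \<in> M_plus \<and> (\<forall>z\<in>ball 0 1. Q c \<nu> z * Q (snd (\<mu>, \<zeta>)) (fst (\<mu>, \<zeta>)) z = 1)"
      using \<open>\<mu> \<in> M_plus\<close> Q_mult_eq_1_iff[OF \<nu>(1) \<mu>(1), of c \<zeta>] ba by (simp add: \<mu>(2) mult.commute)
  next
    fix p assume p: "fst p \<in> M_plus \<and> (\<forall>z\<in>ball 0 1. Q c \<nu> z * Q (snd p) (fst p) z = 1)"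
    then have p_circle: "fst p \<in> circle_measures"
      by (simp add: M_plus_iff)
    then have "?a * herglotz_fps (snd p) (fst p) = 1"
      using p Q_mult_eq_1_iff[OF \<nu>(1)] by blast
    then have "herglotz_fps (snd p) (fst p) = herglotz_fps \<zeta> \<mu>"
      using \<mu>(2) by (simp add: fps_inverse_unique)
    then show "p = (\<mu>, \<zeta>)"
      using herglotz_fps_inject[OF p_circle \<mu>(1)] by (simp add: prod_eq_iff)
  qed
qed

section \<open>Volterra equations with positive semidefinite kernels\<close>

lemma volterra_eq_fps_nth:
  "volterra c K x n = fps_nth (Abs_fps x * (fps_const c + Abs_fps (\<lambda>n. K (int n)))) n"
proof -
  have "fps_nth (Abs_fps x * (fps_const c + Abs_fps (\<lambda>n. K (int n)))) n
      = c * x n + (\<Sum>j=0..n. x j * K (int (n - j)))"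
    by (simp add: ring_distribs fps_mult_nth[of "Abs_fps x" "Abs_fps _"] mult.commute)
  also have "(\<Sum>j=0..n. x j * K (int (n - j))) = (\<Sum>j=0..n. K (int n - int j) * x j)"
    by (intro sum.cong) (auto simp: of_nat_diff)
  finally show ?thesis
    by (simp add: volterra_def)
qed

theorem proposition4p4:
  fixes K K' J :: "int \<Rightarrow> complex"
    and c\<^sub>0 c\<^sub>0' \<zeta>\<^sub>0 :: complex
    and \<zeta>\<^sub>0' :: real
    and lam \<mu> :: "complex measure"
  assumes K: "positive_semidefinite K"
    and c\<^sub>0: "Re c\<^sub>0 \<ge> - (1/2) * Re (K 0)"
    and c\<^sub>0': "c\<^sub>0' = c\<^sub>0 - 2 * of_real (Re c\<^sub>0) - K 0"
    and K': "K' = (\<lambda>n. K n + (if n = 0 then 1 else 0) * (2 * of_real (Re c\<^sub>0) + K 0))"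
    and K'_nz: "K' \<noteq> (\<lambda>n. 0)"
    and lam: "lam = fourier_inv K'"
    and \<mu>: "(\<mu>, \<zeta>\<^sub>0') = B lam (2 * Im c\<^sub>0')"
    and J: "J = (\<lambda>n. 4 * fourier \<mu> n)"
    and \<zeta>\<^sub>0: "\<zeta>\<^sub>0 = 2 * \<i> * of_real \<zeta>\<^sub>0' - (1/2) * J 0"
  shows "positive_semidefinite K'
    \<and> volterra c\<^sub>0' K' = volterra c\<^sub>0 K
    \<and> of_real (Re c\<^sub>0') = - (1/2) * K' 0
    \<and> lam \<in> M_plus \<and> fourier lam = K'
    \<and> \<mu> \<in> M_plus \<and> (\<forall>z\<in>ball 0 1. Q (2 * Im c\<^sub>0') lam z * Q \<zeta>\<^sub>0' \<mu> z = 1)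
    \<and> (\<forall>x y. (\<forall>n. x n = volterra \<zeta>\<^sub>0 J y n) \<longrightarrow> (\<forall>n. y n = volterra c\<^sub>0 K x n))"
proof -
  define d where "d = 2 * Re c\<^sub>0 + Re (K 0)"
  note K0 = positive_semidefinite_at_0_real[OF K]
  have "d \<ge> 0"
    using c\<^sub>0 by (simp add: d_def)
  have K'_eq: "K' n = K n + (if n = 0 then of_real d else 0)" for n
    by (simp add: K' d_def flip: K0)
  have c\<^sub>0'_eq: "c\<^sub>0' = c\<^sub>0 - of_real d"
    by (simp add: c\<^sub>0' d_def flip: K0)
  have K'_psd: "positive_semidefinite K'"
    using positive_semidefinite_add_delta[OF K \<open>d \<ge> 0\<close>] by (simp flip: K'_eq)
  have volterra': "volterra c\<^sub>0' K' = volterra c\<^sub>0 K"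
  proof (intro ext)
    fix x n
    have "(\<Sum>j=0..n. K' (int n - int j) * x j)
        = (\<Sum>j=0..n. K (int n - int j) * x j) + (\<Sum>j=0..n. if j = n then of_real d * x n else 0)"
      unfolding sum.distrib[symmetric] by (intro sum.cong refl) (auto simp: K'_eq algebra_simps)
    then show "volterra c\<^sub>0' K' x n = volterra c\<^sub>0 K x n"
      by (simp add: volterra_def c\<^sub>0'_eq algebra_simps)
  qed
  have Re_c\<^sub>0': "of_real (Re c\<^sub>0') = - (1/2) * K' 0"
    by (subst K'_eq, subst K0) (simp add: c\<^sub>0'_eq d_def complex_eq_iff field_simps)
  have lam': "lam \<in> circle_measures" "fourier lam = K'"
    using fourier_inv_eq[OF K'_psd] by (auto simp: lam)
  then have lam_M: "lam \<in> M_plus"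
    using positive_semidefinite_eq_0[OF K'_psd] K'_nz by (auto simp: M_plus_iff)
  have "fst (B lam (2 * Im c\<^sub>0')) \<in> M_plus \<and>
      (\<forall>z\<in>ball 0 1. Q (2 * Im c\<^sub>0') lam z * Q (snd (B lam (2 * Im c\<^sub>0'))) (fst (B lam (2 * Im c\<^sub>0'))) z = 1)"
    unfolding B_def by (rule theI') (rule B_unique_existence[OF lam_M])
  then have \<mu>': "\<mu> \<in> M_plus" "\<forall>z\<in>ball 0 1. Q (2 * Im c\<^sub>0') lam z * Q \<zeta>\<^sub>0' \<mu> z = 1"
    by (simp_all flip: \<mu>)
  \<comment> \<open>\<open>F\<close> and \<open>G\<close> are the symbols of the two Volterra operators. The shifts by \<open>c\<^sub>0'\<close> and \<open>\<zeta>\<^sub>0\<close> halve the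
    diagonal terms exactly as the Herglotz series do, so the symbols are these series up to the
    factors \<open>1/2\<close> and \<open>2\<close>, which cancel in the product.\<close>
  define F where "F = fps_const c\<^sub>0' + Abs_fps (\<lambda>n. K' (int n))"
  define G where "G = fps_const \<zeta>\<^sub>0 + Abs_fps (\<lambda>n. J (int n))"
  have "herglotz_fps (2 * Im c\<^sub>0') lam = fps_const 2 * F"
  proof (rule fps_ext)
    fix n
    have "K' 0 = - 2 * of_real (Re c\<^sub>0')"
      using Re_c\<^sub>0' by simp
    then show "fps_nth (herglotz_fps (2 * Im c\<^sub>0') lam) n = fps_nth (fps_const 2 * F) n"
      by (simp add: herglotz_fps_def F_def lam'(2) complex_eq_iff)
  qed
  moreover have "herglotz_fps \<zeta>\<^sub>0' \<mu> = fps_const (1/2) * G"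
    by (rule fps_ext) (simp add: herglotz_fps_def G_def \<zeta>\<^sub>0 J field_simps)
  moreover have "herglotz_fps (2 * Im c\<^sub>0') lam * herglotz_fps \<zeta>\<^sub>0' \<mu> = 1"
    using \<mu>' Q_mult_eq_1_iff[OF lam'(1)] by (auto simp: M_plus_iff)
  ultimately have "(fps_const 2 * fps_const (1/2)) * (F * G) = 1"
    by (simp only: mult_ac)
  then have FG: "F * G = 1"
    by simp
  have "y n = volterra c\<^sub>0 K x n" if x: "\<forall>n. x n = volterra \<zeta>\<^sub>0 J y n" for x y n
  proof -
    have "Abs_fps x = Abs_fps y * G"
      by (rule fps_ext) (simp add: x volterra_eq_fps_nth G_def)
    then have "Abs_fps x * F = Abs_fps y * (F * G)"
      by (simp only: mult_ac)
    then have "fps_nth (Abs_fps x * F) n = y n"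
      by (simp add: FG)
    then show ?thesis
      by (simp add: F_def volterra_eq_fps_nth flip: volterra')
  qed
  then show ?thesis
    using K'_psd volterra' Re_c\<^sub>0' lam_M lam'(2) \<mu>' by blast
qed

end
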